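(* Let $I=(c,d)\subset\mathbb{R}$ be an open interval, $p\in(1,\infty)$, $\nu\in\{1,2\}$, and let $w$ be a Lebesgue measurable function on $I$ with $w>0$ a.e. on $I$ and $w^p\in L^1_{\mathrm{loc},(\nu,2)}$. Then $Cs_{p,w}(I)$ is dense in $Ch_{p,w}(I)$ with respect to $\|\cdot\|_{Ch_{p,w}(I)}$.
   Context: The interval $I=(c,d)$ may be bounded or unbounded ($-\infty\le c<d\le\infty$). $\mathfrak{M}(I)$ is the space of all Lebesgue measurable functions $f:I\to[-\infty,\infty]$ (functions equal a.e. are identified). For $x\in I$ put $I_{1,x}:=I_{2,x}^*:=(c,x]$ and $I_{1,x}^*:=I_{2,x}:=[x,d)$. For $\nu\in\{1,2\}$: $$L^1_{\mathrm{loc},(\nu,1)}:=\Big\{f\in\mathfrak{M}(I):\int_{I_{\nu,x}}|f|<\infty\ \forall x\in I\Big\},\qquad L^1_{\mathrm{loc},(\nu,2)}:=\Big\{f\in\mathfrak{M}(I):\int_{I_{\nu,x}^*}|f|<\infty\ \forall x\in I\Big\}.$$ The weighted Cesàro ($\nu=1$) or Copson ($\nu=2$) space is $Cs_{p,w}(I):=\{f\in\mathfrak{M}(I):\|f\|_{Cs_{p,w}(I)}<\infty\}$, where $$\|f\|_{Cs_{p,w}(I)}:=\left(\int_I\left[w(x)\int_{I_{\nu,x}}|f|\right]^p dx\right)^{1/p}.$$ The weighted altered Cesàro–Copson space is $Ch_{p,w}(I):=\{f\in L^1_{\mathrm{loc},(\nu,1)}:\|f\|_{Ch_{p,w}(I)}<\infty\}$,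 where $$\|f\|_{Ch_{p,w}(I)}:=\left(\int_I\left|w(x)\int_{I_{\nu,x}}f\right|^p dx\right)^{1/p}.$$ *)

theory Defs
  imports "HOL-Analysis.Analysis"
begin

text \<open>
  Throughout, \<open>I = einterval c d\<close> with \<open>c, d :: ereal\<close>. Functions on \<open>I\<close> are total functions on the
  reals whose values outside \<open>I\<close> are never used. Functions that agree a.e. on \<open>I\<close> are not
  identified by a quotient: all notions below are invariant under changing a function on a null set.
\<close>

definition meas_fun :: "ereal \<Rightarrow> ereal \<Rightarrow> (real \<Rightarrow> ereal) set" where
  "meas_fun c d = borel_measurable (lebesgue_on (einterval c d))"

definition I_seg :: "ereal \<Rightarrow> ereal \<Rightarrow> nat \<Rightarrow> real \<Rightarrow> real set" where
  "I_seg c d \<nu> x =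
     (if \<nu> = 1 then {t. c < ereal t \<and> t \<le> x} else {t. x \<le> t \<and> ereal t < d})"

definition I_seg_star :: "ereal \<Rightarrow> ereal \<Rightarrow> nat \<Rightarrow> real \<Rightarrow> real set" where
  "I_seg_star c d \<nu> x =
     (if \<nu> = 1 then {t. x \<le> t \<and> ereal t < d} else {t. c < ereal t \<and> t \<le> x})"

definition L1_loc_1 :: "ereal \<Rightarrow> ereal \<Rightarrow> nat \<Rightarrow> (real \<Rightarrow> ereal) set" where
  "L1_loc_1 c d \<nu> = {f \<in> meas_fun c d.
     \<forall>x \<in> einterval c d. (\<integral>\<^sup>+t\<in>I_seg c d \<nu> x. e2ennreal \<bar>f t\<bar> \<partial>lebesgue) < \<infinity>}"

definition L1_loc_2 :: "ereal \<Rightarrow> ereal \<Rightarrow> nat \<Rightarrow> (real \<Rightarrow> ereal) set" where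
  "L1_loc_2 c d \<nu> = {f \<in> meas_fun c d.
     \<forall>x \<in> einterval c d. (\<integral>\<^sup>+t\<in>I_seg_star c d \<nu> x. e2ennreal \<bar>f t\<bar> \<partial>lebesgue) < \<infinity>}"

text \<open>Real powers of extended nonnegative reals; only used for exponents \<open>a > 0\<close>, where
  \<open>0\<close> and \<open>\<infinity>\<close> are mapped to themselves.\<close>

definition epowr :: "ennreal \<Rightarrow> real \<Rightarrow> ennreal" where
  "epowr x a = (if x = \<infinity> then \<infinity> else ennreal (enn2real x powr a))"

text \<open>The conversion \<open>e2ennreal\<close> replaces negative values by \<open>0\<close>; for a weight
  \<open>w > 0\<close> a.e., this changes \<open>w\<close> on a null set only.\<close>

definition Cs_norm ::
  "ereal \<Rightarrow> ereal \<Rightarrow> nat \<Rightarrow> real \<Rightarrow> (real \<Rightarrow> ereal) \<Rightarrow> (real \<Rightarrow> ereal) \<Rightarrow> ennreal" where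
  "Cs_norm c d \<nu> p w f =
     epowr (\<integral>\<^sup>+x\<in>einterval c d.
       epowr (e2ennreal (w x) * (\<integral>\<^sup>+t\<in>I_seg c d \<nu> x. e2ennreal \<bar>f t\<bar> \<partial>lebesgue)) p \<partial>lebesgue) (1 / p)"

definition Cs ::
  "ereal \<Rightarrow> ereal \<Rightarrow> nat \<Rightarrow> real \<Rightarrow> (real \<Rightarrow> ereal) \<Rightarrow> (real \<Rightarrow> ereal) set" where
  "Cs c d \<nu> p w = {f \<in> meas_fun c d. Cs_norm c d \<nu> p w f < \<infinity>}"

text \<open>The altered norm is only meant for \<open>f \<in> L1_loc_1 c d \<nu>\<close>. Such \<open>f\<close> is finite a.e. and
  integrable on every \<open>I_seg c d \<nu> x\<close>, so the Bochner integral of \<open>real_of_ereal \<circ> f\<close>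
  (where \<open>real_of_ereal\<close> maps the infinite values to \<open>0\<close>) is the Lebesgue integral of \<open>f\<close>.\<close>

definition Ch_norm ::
  "ereal \<Rightarrow> ereal \<Rightarrow> nat \<Rightarrow> real \<Rightarrow> (real \<Rightarrow> ereal) \<Rightarrow> (real \<Rightarrow> ereal) \<Rightarrow> ennreal" where
  "Ch_norm c d \<nu> p w f =
     epowr (\<integral>\<^sup>+x\<in>einterval c d.
       epowr (e2ennreal \<bar>w x * ereal (LINT t:I_seg c d \<nu> x|lebesgue. real_of_ereal (f t))\<bar>) p
         \<partial>lebesgue) (1 / p)"

definition Ch ::
  "ereal \<Rightarrow> ereal \<Rightarrow> nat \<Rightarrow> real \<Rightarrow> (real \<Rightarrow> ereal) \<Rightarrow> (real \<Rightarrow> ereal) set" where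
  "Ch c d \<nu> p w = {f \<in> L1_loc_1 c d \<nu>. Ch_norm c d \<nu> p w f < \<infinity>}"

text \<open>Density of \<open>A\<close> in \<open>B\<close> with respect to \<open>N\<close>, including that \<open>A\<close> is a subset of \<open>B\<close>.
  For a.e. finite \<open>f\<close>, \<open>g\<close>, the convention for \<open>\<infinity> - \<infinity>\<close> matters on a null set only.\<close>

definition dense_wrt ::
  "((real \<Rightarrow> ereal) \<Rightarrow> ennreal) \<Rightarrow> (real \<Rightarrow> ereal) set \<Rightarrow> (real \<Rightarrow> ereal) set \<Rightarrow> bool" where
  "dense_wrt N A B \<longleftrightarrow>
     A \<subseteq> B \<and> (\<forall>f\<in>B. \<forall>\<epsilon>::real. \<epsilon> > 0 \<longrightarrow> (\<exists>g\<in>A. N (\<lambda>x. f x - g x) < ennreal \<epsilon>))"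

end

theory Submission
  imports Defs
begin

text \<open>
  Write \<open>F(x)\<close> for the integral of \<open>f\<close> over \<open>I_seg c d \<nu> x\<close>. The space \<open>Ch\<close> only asks for
  \<open>w F \<in> L\<^sup>p\<close>, which may hold thanks to cancellation in \<open>f\<close>. For \<open>\<nu> = 1\<close> there are two places where
  \<open>f\<close> may fail to lie in \<open>Cs\<close>: near \<open>c\<close>, where \<open>w\<close> may be too large, and near \<open>d\<close>, where \<open>f\<close> need not
  be integrable. Removing \<open>f\<close> near both endpoints repairs this, but restricting \<open>f\<close> to a smaller
  interval shifts \<open>F\<close> by a constant on a long range, which is not a small error. The
  remedy is to restore the lost mass \<open>F(a)\<close> at once by a bump of integral \<open>F(a)\<close> on a very short
  interval just after \<open>a\<close>.

  The lemma \<open>prim_cutoff\<close> makes this precise: the modified function \<open>T\<^sub>a f = cutoff a a' f\<close> has primitive \<open>0\<close> on the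
  segment of \<open>a\<close> and primitive \<open>F\<close> after the bump, while on the bump the error is at most \<open>\<bar>F(a)\<bar>\<close>. The
  approximant is \<open>g = T\<^sub>a f - T\<^sub>b f\<close>, with \<open>a\<close> near the initial endpoint and \<open>b\<close> near the final one.
  The error \<open>F - G\<close> is then bounded by \<open>\<bar>F\<bar>\<close> near both endpoints, plus \<open>\<bar>F(a)\<bar>\<close> and \<open>\<bar>F(b)\<bar>\<close> on the two
  bumps. The first two contributions are small because \<open>\<bar>w F\<bar>\<^sup>p\<close> is integrable; once \<open>a\<close>
  and \<open>b\<close> are chosen, the other two are small if the bumps are short, because \<open>w\<^sup>p\<close> is integrable away
  from the initial endpoint (\<open>cutoff_approximation\<close>). Finally \<open>g\<close> is integrable and vanishes near the initial
  endpoint, so the primitive of \<open>\<bar>g\<bar>\<close> is bounded and vanishes there, which puts \<open>g\<close> in \<open>Cs\<close>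
  (\<open>integrable_truncation_in_Cs\<close>).

  Both values of \<open>\<nu>\<close> are treated at once: the argument uses only that the segments form a chain of
  sets that shrinks to the empty set, exhausts the interval and is continuous from the right.
  The locale \<open>segment_chain\<close> records these properties.
\<close>

section \<open>Powers and weights in the extended nonnegative reals\<close>

lemma powr_add_le:
  fixes x y p :: real
  assumes "0 \<le> x" "0 \<le> y" "0 < p"
  shows "(x + y) powr p \<le> 2 powr p * (x powr p + y powr p)"
proof -
  have "(x + y) powr p \<le> (2 * max x y) powr p"
    using assms by (intro powr_mono2) auto
  also have "\<dots> = 2 powr p * (max x y) powr p"
    using assms by (simp add: powr_mult)
  also have "(max x y) powr p \<le> x powr p + y powr p"
    by (simp add: max_def)
  finally show ?thesis by simp
qed

text \<open>The convention \<open>0 * \<infinity> = 0\<close> is respected on both sides because a positive power fixes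
  \<open>0\<close> and \<open>\<infinity>\<close>. This is what lets the weight be pulled out of the norms without
  first discarding the points where it is infinite.\<close>

lemma epowr_mult:
  assumes "0 < p"
  shows "epowr (x * y) p = epowr x p * epowr y p"
proof (cases x; cases y)
  fix r s :: real
  assume "0 \<le> r" "x = ennreal r" "0 \<le> s" "y = ennreal s"
  then show ?thesis
    by (simp add: epowr_def powr_mult enn2real_mult flip: ennreal_mult)
next
  fix r :: real
  assume "0 \<le> r" "x = ennreal r" "y = top"
  then show ?thesis
    using assms by (cases "r = 0") (auto simp: epowr_def ennreal_mult_top)
next
  fix s :: real
  assume "x = top" "0 \<le> s" "y = ennreal s"
  then show ?thesis
    using assms by (cases "s = 0") (auto simp: epowr_def ennreal_top_mult)
next
  assume "x = top" "y = top"
  then show ?thesis by (simp add: epowr_def)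
qed

lemma epowr_ennreal: "0 \<le> r \<Longrightarrow> epowr (ennreal r) p = ennreal (r powr p)"
  by (simp add: epowr_def)

lemma epowr_mono:
  assumes "x \<le> y" "0 < p"
  shows "epowr x p \<le> epowr y p"
  using assms
  by (cases x; cases y) (auto simp: epowr_def top_unique intro!: powr_mono2 ennreal_leI)

lemma epowr_less_top_iff [simp]: "epowr x p < top \<longleftrightarrow> x < top"
  by (cases x) (auto simp: epowr_def)

lemma epowr_inverse_less:
  assumes "0 < p" "0 < e" "x < ennreal (e powr p)"
  shows "epowr x (1 / p) < ennreal e"
proof -
  obtain r where r: "x = ennreal r" "0 \<le> r" "r < e powr p"
    using assms by (cases x) (auto simp: ennreal_less_iff)
  have "r powr (1 / p) < (e powr p) powr (1 / p)"
    using r assms by (intro powr_less_mono2) auto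
  then show ?thesis
    using assms r by (simp add: epowr_ennreal powr_powr ennreal_less_iff)
qed

lemma epowr_borel_measurable [measurable]: "(\<lambda>x. epowr x p) \<in> borel_measurable borel"
  unfolding epowr_def by measurable

lemma e2ennreal_abs_mult:
  assumes "0 \<le> w"
  shows "e2ennreal \<bar>w * ereal r\<bar> = e2ennreal w * ennreal \<bar>r\<bar>"
proof (cases w)
  case (real s)
  with assms show ?thesis by (simp add: abs_mult ennreal_mult)
next
  case PInf
  then show ?thesis by (cases "r = 0") (auto simp: ennreal_top_mult zero_ereal_def[symmetric] e2ennreal_neg)
qed (use assms in auto)

lemma epowr_weight_mult:
  assumes "0 \<le> w" "0 < p"
  shows "epowr (e2ennreal \<bar>w * ereal r\<bar>) p = epowr (e2ennreal w) p * ennreal (\<bar>r\<bar> powr p)"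
  using assms by (simp add: e2ennreal_abs_mult epowr_mult epowr_ennreal)

section \<open>Integrals over shrinking sets\<close>

lemma nn_integral_decseq_small:
  assumes h [measurable]: "h \<in> borel_measurable M"
    and B [measurable]: "B \<in> sets M" and fin: "(\<integral>\<^sup>+x\<in>B. h x \<partial>M) < \<infinity>"
    and A: "range A \<subseteq> sets M" "decseq A" "(\<Inter>n. A n) = {}" "\<And>n. A n \<subseteq> B"
    and e: "0 < (e :: ennreal)"
  shows "\<exists>n. (\<integral>\<^sup>+x\<in>A n. h x \<partial>M) < e"
proof -
  have "(\<lambda>n. emeasure (density M h) (A n)) \<longlonglongrightarrow> emeasure (density M h) (\<Inter>n. A n)"
  proof (rule Lim_emeasure_decseq)
    show "emeasure (density M h) (A n) \<noteq> \<infinity>" for n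
    proof -
      have "emeasure (density M h) (A n) \<le> emeasure (density M h) B"
        using A by (intro emeasure_mono) auto
      also have "\<dots> < \<infinity>" using fin by (simp add: emeasure_density)
      finally show ?thesis by simp
    qed
  qed (use A in auto)
  then have "(\<lambda>n. emeasure (density M h) (A n)) \<longlonglongrightarrow> 0" using A by simp
  from order_tendstoD(2)[OF this e] obtain n where "emeasure (density M h) (A n) < e"
    by (auto simp: eventually_sequentially)
  moreover have "A n \<in> sets M" using A by auto
  ultimately show ?thesis by (auto simp: emeasure_density)
qed

lemma sigma_finite_lebesgue: "sigma_finite_measure (lebesgue :: 'a::euclidean_space measure)"
proof
  have "(\<Union>n::nat. cball (0 :: 'a) (real n)) = UNIV"
    by (auto intro!: real_arch_simple)
  moreover have "emeasure lebesgue (cball (0 :: 'a) r) \<noteq> \<infinity>" for r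
    using lmeasurable_cball[of "0 :: 'a" r] by (auto simp: fmeasurable_def)
  ultimately show "\<exists>A. countable A \<and> A \<subseteq> sets (lebesgue :: 'a measure) \<and>
      \<Union>A = space lebesgue \<and> (\<forall>a\<in>A. emeasure lebesgue a \<noteq> \<infinity>)"
    by (intro exI[of _ "range (\<lambda>n::nat. cball 0 (real n))"]) auto
qed

section \<open>Chains of segments and the cutoff of a function\<close>

text \<open>
  An abstraction of the segments \<open>(c, x]\<close> and of the segments \<open>[x, d)\<close>: \<open>S x\<close> stands for the
  points up to and including \<open>x\<close> in a total order of \<open>I\<close>. The joint measurability \<open>seg_joint\<close> makes
  integrals over \<open>S x\<close> measurable functions of \<open>x\<close> by Fubini. The sets \<open>S (y n) - S x\<close> of
  \<open>seg_right_cont\<close> are the places for the bumps, so they need positive finite measure and must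
  shrink to the empty set.
\<close>

locale segment_chain = sigma_finite_measure M for M :: "'a measure" +
  fixes I :: "'a set" and S :: "'a \<Rightarrow> 'a set"
  assumes I_sets [measurable]: "I \<in> sets M"
    and seg_subset: "x \<in> I \<Longrightarrow> S x \<subseteq> I"
    and seg_refl: "x \<in> I \<Longrightarrow> x \<in> S x"
    and seg_mono: "x \<in> I \<Longrightarrow> y \<in> I \<Longrightarrow> x \<in> S y \<Longrightarrow> S x \<subseteq> S y"
    and seg_total: "x \<in> I \<Longrightarrow> y \<in> I \<Longrightarrow> x \<notin> S y \<Longrightarrow> y \<in> S x"
    and seg_joint: "{z \<in> space (M \<Otimes>\<^sub>M M). fst z \<in> I \<and> snd z \<in> S (fst z)} \<in> sets (M \<Otimes>\<^sub>M M)"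
    and seg_to_empty: "\<exists>a :: nat \<Rightarrow> 'a. range a \<subseteq> I \<and> decseq (\<lambda>n. S (a n)) \<and> (\<Inter>n. S (a n)) = {}"
    and seg_to_all: "\<exists>b :: nat \<Rightarrow> 'a. range b \<subseteq> I \<and> incseq (\<lambda>n. S (b n)) \<and> (\<Union>n. S (b n)) = I"
    and seg_right_cont: "x \<in> I \<Longrightarrow> \<exists>y :: nat \<Rightarrow> 'a. range y \<subseteq> I \<and> decseq (\<lambda>n. S (y n)) \<and>
        (\<Inter>n. S (y n)) = S x \<and>
        (\<forall>n. 0 < emeasure M (S (y n) - S x) \<and> emeasure M (S (y n) - S x) < \<infinity>)"
begin

lemma seg_sets [measurable]:
  assumes "x \<in> I"
  shows "S x \<in> sets M"
proof -
  have "I \<subseteq> space M" using sets.sets_into_space[OF I_sets] .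
  then have "Pair x -` {z \<in> space (M \<Otimes>\<^sub>M M). fst z \<in> I \<and> snd z \<in> S (fst z)} = S x"
    using assms seg_subset[OF assms] by (auto simp: space_pair_measure)
  then show ?thesis using sets_Pair1[OF seg_joint, of x] by simp
qed

lemma seg_mono': "x \<in> I \<Longrightarrow> y \<in> I \<Longrightarrow> x \<notin> S y \<Longrightarrow> S y \<subseteq> S x"
  using seg_total seg_mono by blast

definition prim :: "('a \<Rightarrow> real) \<Rightarrow> 'a \<Rightarrow> real" where
  "prim f x = (LINT t:S x|M. f t)"

lemma prim_measurable:
  assumes [measurable]: "f \<in> borel_measurable M"
  shows "(\<lambda>x. indicator I x * prim f x) \<in> borel_measurable M"
proof -
  let ?E = "{z \<in> space (M \<Otimes>\<^sub>M M). fst z \<in> I \<and> snd z \<in> S (fst z)}"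
  note seg_joint [measurable]
  have "(\<lambda>x. \<integral>t. indicator ?E (x, t) *\<^sub>R f t \<partial>M) \<in> borel_measurable M"
    by (rule borel_measurable_lebesgue_integral) measurable
  moreover have "(\<integral>t. indicator ?E (x, t) *\<^sub>R f t \<partial>M) = indicator I x * prim f x"
    if "x \<in> space M" for x
  proof (cases "x \<in> I")
    case True
    then show ?thesis
      using that unfolding prim_def set_lebesgue_integral_def
      by (auto intro!: Bochner_Integration.integral_cong
          simp: space_pair_measure indicator_def)
  qed auto
  ultimately show ?thesis by (rule measurable_cong[THEN iffD1, rotated])
qed

text \<open>The function is removed on \<open>S a\<close> and the integral that is lost there is spread evenly over
  \<open>S a' - S a\<close>.\<close>

definition cutoff :: "'a \<Rightarrow> 'a \<Rightarrow> ('a \<Rightarrow> real) \<Rightarrow> 'a \<Rightarrow> real" where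
  "cutoff a a' f t = f t * (1 - indicator (S a) t)
     + prim f a * (indicator (S a' - S a) t / measure M (S a' - S a))"

lemma cutoff_measurable:
  assumes [measurable]: "f \<in> borel_measurable M" and "a \<in> I" "a' \<in> I"
  shows "cutoff a a' f \<in> borel_measurable M"
proof -
  note [measurable] = seg_sets[OF \<open>a \<in> I\<close>] seg_sets[OF \<open>a' \<in> I\<close>]
  show ?thesis unfolding cutoff_def[abs_def] by measurable
qed

lemma bump_integral:
  assumes "a \<in> I" "a' \<in> I" "x \<in> I" and fin: "emeasure M (S a' - S a) < \<infinity>"
  shows "set_integrable M (S x) (indicator (S a' - S a) :: 'a \<Rightarrow> real)"
    and "(LINT t:S x|M. indicator (S a' - S a) t) = measure M (S x \<inter> (S a' - S a))"
proof -
  note [measurable] = seg_sets[OF \<open>a \<in> I\<close>] seg_sets[OF \<open>a' \<in> I\<close>] seg_sets[OF \<open>x \<in> I\<close>]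
  have sp: "S x \<inter> (S a' - S a) \<inter> space M = S x \<inter> (S a' - S a)"
    by (rule Int_absorb2, rule sets.sets_into_space) measurable
  have eq: "(\<lambda>t. indicator (S x) t *\<^sub>R (indicator (S a' - S a) t :: real))
      = indicator (S x \<inter> (S a' - S a))"
    by (auto simp: indicator_def fun_eq_iff)
  have "emeasure M (S x \<inter> (S a' - S a)) \<le> emeasure M (S a' - S a)"
    by (intro emeasure_mono) auto
  with fin have "emeasure M (S x \<inter> (S a' - S a)) < \<infinity>" by (rule order.strict_trans1[rotated])
  then show "set_integrable M (S x) (indicator (S a' - S a) :: 'a \<Rightarrow> real)"
    unfolding set_integrable_def eq by (intro integrable_real_indicator) auto
  show "(LINT t:S x|M. indicator (S a' - S a) t) = measure M (S x \<inter> (S a' - S a))"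
    unfolding set_lebesgue_integral_def eq using sp by simp
qed

lemma truncation_integral:
  assumes f: "\<And>x. x \<in> I \<Longrightarrow> set_integrable M (S x) f" and "a \<in> I" "x \<in> I"
  shows "set_integrable M (S x) (\<lambda>t. f t * (1 - indicator (S a) t))"
    and "(LINT t:S x|M. f t * (1 - indicator (S a) t))
      = (if x \<in> S a then 0 else prim f x - prim f a)"
proof -
  show "set_integrable M (S x) (\<lambda>t. f t * (1 - indicator (S a) t))"
  proof -
    note [measurable] = seg_sets[OF \<open>a \<in> I\<close>] seg_sets[OF \<open>x \<in> I\<close>]
    have "integrable M (\<lambda>t. indicator (S x - S a) t *\<^sub>R (indicator (S x) t *\<^sub>R f t))"
      using f[OF \<open>x \<in> I\<close>] unfolding set_integrable_def
      by (rule integrable_mult_indicator[rotated]) measurable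
    also have "(\<lambda>t. indicator (S x - S a) t *\<^sub>R (indicator (S x) t *\<^sub>R f t))
        = (\<lambda>t. indicator (S x) t *\<^sub>R (f t * (1 - indicator (S a) t)))"
      by (auto simp: indicator_def fun_eq_iff)
    finally show ?thesis unfolding set_integrable_def .
  qed
  show "(LINT t:S x|M. f t * (1 - indicator (S a) t))
      = (if x \<in> S a then 0 else prim f x - prim f a)"
  proof (cases "x \<in> S a")
    case True
    then have "(\<lambda>t. indicator (S x) t *\<^sub>R (f t * (1 - indicator (S a) t))) = (\<lambda>t. 0)"
      using seg_mono[OF \<open>x \<in> I\<close> \<open>a \<in> I\<close>] by (auto simp: indicator_def fun_eq_iff)
    with True show ?thesis by (simp add: set_lebesgue_integral_def)
  next
    case False
    then have "(\<lambda>t. indicator (S x) t *\<^sub>R (f t * (1 - indicator (S a) t)))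
        = (\<lambda>t. indicator (S x) t *\<^sub>R f t - indicator (S a) t *\<^sub>R f t)"
      using seg_mono'[OF \<open>x \<in> I\<close> \<open>a \<in> I\<close>] by (auto simp: indicator_def fun_eq_iff)
    with False show ?thesis
      using f[OF \<open>x \<in> I\<close>] f[OF \<open>a \<in> I\<close>]
      by (simp add: set_lebesgue_integral_def prim_def set_integrable_def)
  qed
qed

lemma cutoff_integrable:
  assumes f: "\<And>x. x \<in> I \<Longrightarrow> set_integrable M (S x) f"
    and "a \<in> I" "a' \<in> I" "x \<in> I" and fin: "emeasure M (S a' - S a) < \<infinity>"
  shows "set_integrable M (S x) (cutoff a a' f)"
  unfolding cutoff_def[abs_def]
  using truncation_integral(1)[OF f \<open>a \<in> I\<close> \<open>x \<in> I\<close>] bump_integral(1)[OF assms(2-5)]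
  by (intro set_integral_add(1) set_integrable_mult_right set_integrable_divide) auto

text \<open>At a point of the bump, the part of the mass \<open>prim f a\<close> that has been restored is the fraction
  \<open>\<theta>\<close> of the bump that has been passed, so the error is \<open>(1 - \<theta>) * prim f a\<close>. Before the bump nothing
  has been integrated, and after it the whole mass is back.\<close>

lemma prim_cutoff:
  assumes f: "\<And>x. x \<in> I \<Longrightarrow> set_integrable M (S x) f"
    and a: "a \<in> I" "a' \<in> I" and x: "x \<in> I"
    and D: "0 < emeasure M (S a' - S a)" "emeasure M (S a' - S a) < \<infinity>"
  shows "\<bar>prim (cutoff a a' f) x - prim f x * (1 - indicator (S a) x)\<bar>
    \<le> \<bar>prim f a\<bar> * indicator (S a' - S a) x"
proof -
  define m where "m = measure M (S a' - S a)"
  define \<theta> where "\<theta> = measure M (S x \<inter> (S a' - S a)) / m"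
  note [measurable] = seg_sets[OF a(1)] seg_sets[OF a(2)] seg_sets[OF x]
  have m: "0 < m"
    using D unfolding m_def by (simp add: measure_def enn2real_positive_iff)
  have \<theta>: "0 \<le> \<theta>" "\<theta> \<le> 1"
  proof -
    have "measure M (S x \<inter> (S a' - S a)) \<le> m"
      unfolding m_def using D by (intro measure_mono_fmeasurable) (auto simp: fmeasurable_def)
    with m show "0 \<le> \<theta>" "\<theta> \<le> 1" by (auto simp: \<theta>_def)
  qed
  have "prim (cutoff a a' f) x
      = (LINT t:S x|M. f t * (1 - indicator (S a) t))
        + (LINT t:S x|M. prim f a * (indicator (S a' - S a) t / m))"
    unfolding cutoff_def[abs_def] prim_def[of _ x] m_def
    using truncation_integral(1)[OF f a(1) x] bump_integral(1)[OF a x D(2)]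
    by (intro set_integral_add(2) set_integrable_mult_right set_integrable_divide) auto
  also have "\<dots> = (if x \<in> S a then 0 else prim f x - prim f a) + prim f a * \<theta>"
    using truncation_integral(2)[OF f a(1) x] bump_integral(2)[OF a x D(2)] by (simp add: \<theta>_def)
  finally have eq: "prim (cutoff a a' f) x = \<dots>" .
  consider "x \<in> S a" | "x \<notin> S a" "x \<in> S a'" | "x \<notin> S a" "x \<notin> S a'" by blast
  then show ?thesis
  proof cases
    case 1
    then have "S x \<inter> (S a' - S a) = {}" using seg_mono[OF x a(1)] by auto
    then have "\<theta> = 0" by (simp add: \<theta>_def)
    with 1 eq show ?thesis by simp
  next
    case 2
    have "\<bar>prim f a * \<theta> - prim f a\<bar> = \<bar>prim f a\<bar> * \<bar>\<theta> - 1\<bar>"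
      by (simp add: abs_mult[symmetric] algebra_simps)
    also have "\<dots> \<le> \<bar>prim f a\<bar> * 1" using \<theta> by (intro mult_left_mono) auto
    finally show ?thesis using 2 eq by simp
  next
    case 3
    then have "S x \<inter> (S a' - S a) = S a' - S a" using seg_mono'[OF x a(2)] by auto
    then have "\<theta> = 1" using m by (simp add: \<theta>_def m_def)
    with 3 eq show ?thesis by simp
  qed
qed

text \<open>A jump of fixed height costs little if it is repaired fast enough: the weighted size of
  the bump region tends to \<open>0\<close> as \<open>a'\<close> approaches \<open>a\<close>.\<close>

lemma bump_point:
  assumes W [measurable]: "W \<in> borel_measurable M" and a: "a \<in> I"
    and tail: "(\<integral>\<^sup>+x\<in>I - S a. W x \<partial>M) < \<infinity>" and e: "0 < (e :: ennreal)"
  obtains a' where "a' \<in> I" "0 < emeasure M (S a' - S a)" "emeasure M (S a' - S a) < \<infinity>"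
    "(\<integral>\<^sup>+x\<in>S a' - S a. W x * ennreal k \<partial>M) < e"
proof -
  obtain y :: "nat \<Rightarrow> 'a" where y: "range y \<subseteq> I" "decseq (\<lambda>n. S (y n))" "(\<Inter>n. S (y n)) = S a"
      "\<And>n. 0 < emeasure M (S (y n) - S a)" "\<And>n. emeasure M (S (y n) - S a) < \<infinity>"
    using seg_right_cont[OF a] by metis
  have yI: "y n \<in> I" for n using y(1) by auto
  note [measurable] = seg_sets[OF a] seg_sets[OF yI]
  have "(\<integral>\<^sup>+x\<in>I - S a. W x * ennreal k \<partial>M) = (\<integral>\<^sup>+x\<in>I - S a. W x \<partial>M) * ennreal k"
    by (subst nn_integral_multc[symmetric]) (auto simp: mult_ac)
  then have "(\<integral>\<^sup>+x\<in>I - S a. W x * ennreal k \<partial>M) < \<infinity>"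
    using tail by (simp add: ennreal_mult_less_top)
  then obtain n where "(\<integral>\<^sup>+x\<in>S (y n) - S a. W x * ennreal k \<partial>M) < e"
    using nn_integral_decseq_small[where h = "\<lambda>x. W x * ennreal k" and B = "I - S a"
        and A = "\<lambda>n. S (y n) - S a" and M = M and e = e] e
    using y(2,3) seg_subset[OF yI] by (fastforce simp: decseq_def)
  with that[OF yI y(4) y(5)] show ?thesis by blast
qed

text \<open>
  The approximant is a difference of two cutoffs, \<open>g = cutoff a a' f - cutoff b b' f\<close>. Away from
  \<open>S a \<union> S b\<close> the two copies of \<open>f\<close> cancel, which makes \<open>g\<close> integrable on all of \<open>I\<close>. The point \<open>z\<close> is the
  smaller of \<open>a\<close> and \<open>b\<close>, so that both cutoffs vanish on \<open>S z\<close>. The weight \<open>W\<close> stands for \<open>w\<^sup>p\<close>.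
\<close>

lemma cutoff_approximation:
  fixes f :: "'a \<Rightarrow> real" and W :: "'a \<Rightarrow> ennreal" and p :: real and e :: ennreal
  assumes W [measurable]: "W \<in> borel_measurable M"
    and tail: "\<And>x. x \<in> I \<Longrightarrow> (\<integral>\<^sup>+t\<in>I - S x. W t \<partial>M) < \<infinity>"
    and fm [measurable]: "f \<in> borel_measurable M"
    and f: "\<And>x. x \<in> I \<Longrightarrow> set_integrable M (S x) f"
    and fin: "(\<integral>\<^sup>+x\<in>I. W x * ennreal (\<bar>prim f x\<bar> powr p) \<partial>M) < \<infinity>"
    and p: "0 < p" and e: "0 < e"
  obtains g z where "g \<in> borel_measurable M" "z \<in> I" "set_integrable M I g"
    "\<And>t. t \<in> S z \<Longrightarrow> g t = 0"
    "(\<integral>\<^sup>+x\<in>I. W x * ennreal (\<bar>prim f x - prim g x\<bar> powr p) \<partial>M) < e"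
proof -
  \<comment> \<open>The error is a sum of four terms. Applying \<open>powr_add_le\<close> to two nested sums of two terms costs the
    factor \<open>2 powr p * 2 powr p\<close>, so each term may contribute a quarter of \<open>e / 4 powr p\<close>.\<close>
  define k where "k = ennreal (4 powr p)"
  define r where "r = e / (4 * k)"
  have k: "k \<noteq> 0" "k \<noteq> top" by (auto simp: k_def)
  have r: "0 < r" using e k by (simp add: r_def ennreal_zero_less_divide ennreal_mult_less_top less_top)
  \<comment> \<open>The indicator is there for measurability: nothing is assumed about \<open>S x\<close> for \<open>x\<close> outside \<open>I\<close>.\<close>
  define V where "V x = W x * ennreal (\<bar>indicator I x * prim f x\<bar> powr p)" for x
  have V [measurable]: "V \<in> borel_measurable M"
    unfolding V_def[abs_def] using prim_measurable[OF fm] by measurable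
  have V_eq: "V x = W x * ennreal (\<bar>prim f x\<bar> powr p)" if "x \<in> I" for x
    using that by (simp add: V_def)
  have V_fin: "(\<integral>\<^sup>+x\<in>I. V x \<partial>M) < \<infinity>"
    using fin by (subst nn_integral_cong[where v = "\<lambda>x. W x * ennreal (\<bar>prim f x\<bar> powr p) * indicator I x"])
      (auto simp: V_eq split: split_indicator)
  obtain a where a: "a \<in> I" "(\<integral>\<^sup>+x\<in>S a. V x \<partial>M) < r"
  proof -
    obtain s :: "nat \<Rightarrow> 'a" where s: "range s \<subseteq> I" "decseq (\<lambda>n. S (s n))" "(\<Inter>n. S (s n)) = {}"
      using seg_to_empty by blast
    have sI: "s n \<in> I" for n using s(1) by auto
    obtain n where "(\<integral>\<^sup>+x\<in>S (s n). V x \<partial>M) < r"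
      using nn_integral_decseq_small[OF V I_sets V_fin _ s(2,3) _ r] seg_sets[OF sI]
        seg_subset[OF sI] by blast
    with that sI show ?thesis by blast
  qed
  obtain b where b: "b \<in> I" "(\<integral>\<^sup>+x\<in>I - S b. V x \<partial>M) < r"
  proof -
    obtain s :: "nat \<Rightarrow> 'a" where s: "range s \<subseteq> I" "incseq (\<lambda>n. S (s n))" "(\<Union>n. S (s n)) = I"
      using seg_to_all by blast
    have sI: "s n \<in> I" for n using s(1) by auto
    note [measurable] = seg_sets[OF sI]
    have "range (\<lambda>n. I - S (s n)) \<subseteq> sets M" by auto
    moreover have "decseq (\<lambda>n. I - S (s n))" "(\<Inter>n. I - S (s n)) = {}"
      using s(2,3) by (auto simp: decseq_def incseq_def)
    ultimately obtain n where "(\<integral>\<^sup>+x\<in>I - S (s n). V x \<partial>M) < r"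
      using nn_integral_decseq_small[OF V I_sets V_fin _ _ _ _ r, of "\<lambda>n. I - S (s n)"] by blast
    with that sI show ?thesis by blast
  qed
  define A B where "A = \<bar>prim f a\<bar> powr p" and "B = \<bar>prim f b\<bar> powr p"
  obtain a' where a': "a' \<in> I" "0 < emeasure M (S a' - S a)" "emeasure M (S a' - S a) < \<infinity>"
      "(\<integral>\<^sup>+x\<in>S a' - S a. W x * ennreal A \<partial>M) < r"
    by (rule bump_point[OF W a(1) tail[OF a(1)] r])
  obtain b' where b': "b' \<in> I" "0 < emeasure M (S b' - S b)" "emeasure M (S b' - S b) < \<infinity>"
      "(\<integral>\<^sup>+x\<in>S b' - S b. W x * ennreal B \<partial>M) < r"
    by (rule bump_point[OF W b(1) tail[OF b(1)] r])
  note [measurable] = seg_sets[OF a(1)] seg_sets[OF b(1)] seg_sets[OF a'(1)] seg_sets[OF b'(1)]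
  define g where "g t = cutoff a a' f t - cutoff b b' f t" for t
  have g_meas: "g \<in> borel_measurable M"
    unfolding g_def[abs_def] using cutoff_measurable[OF fm] a(1) a'(1) b(1) b'(1) by measurable
  have prim_g: "prim g x = prim (cutoff a a' f) x - prim (cutoff b b' f) x" if "x \<in> I" for x
    unfolding g_def[abs_def] prim_def
    using cutoff_integrable[OF f a(1) a'(1) that a'(3)] cutoff_integrable[OF f b(1) b'(1) that b'(3)]
    by (rule set_integral_diff(2))
  have g_int: "set_integrable M I g"
  proof -
    have D: "integrable M (indicator D :: 'a \<Rightarrow> real)" if "D \<in> sets M" "emeasure M D < \<infinity>" for D
      using that by (rule integrable_real_indicator)
    have f2: "integrable M (\<lambda>t. indicator (S a \<union> S b) t *\<^sub>R f t)"
    proof -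
      have "S a \<union> S b = S a \<or> S a \<union> S b = S b"
        using seg_mono[OF a(1) b(1)] seg_mono'[OF a(1) b(1)] by blast
      then show ?thesis using f[OF a(1)] f[OF b(1)] by (auto simp: set_integrable_def)
    qed
    have f3: "integrable M (\<lambda>t. (indicator (S b) t - indicator (S a) t) * (indicator (S a \<union> S b) t *\<^sub>R f t))"
      by (rule Bochner_Integration.integrable_bound[OF f2]) (auto simp: indicator_def)
    have "integrable M (\<lambda>t. (indicator (S b) t - indicator (S a) t) * (indicator (S a \<union> S b) t *\<^sub>R f t)
        + prim f a * (indicator (S a' - S a) t / measure M (S a' - S a))
        - prim f b * (indicator (S b' - S b) t / measure M (S b' - S b)))"
      using a'(3) b'(3)
      by (intro Bochner_Integration.integrable_add Bochner_Integration.integrable_diff f3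
          integrable_mult_right integrable_divide D) auto
    also have "(\<lambda>t. (indicator (S b) t - indicator (S a) t) * (indicator (S a \<union> S b) t *\<^sub>R f t)
        + prim f a * (indicator (S a' - S a) t / measure M (S a' - S a))
        - prim f b * (indicator (S b' - S b) t / measure M (S b' - S b))) = g"
      by (auto simp: g_def cutoff_def indicator_def fun_eq_iff)
    finally show ?thesis unfolding set_integrable_def by (intro integrable_mult_indicator) auto
  qed
  obtain z where z: "z \<in> I" "S z \<subseteq> S a" "S z \<subseteq> S b"
    using a(1) b(1) seg_mono[OF a(1) b(1)] seg_mono'[OF a(1) b(1)] by blast
  have g_zero: "g t = 0" if "t \<in> S z" for t
  proof -
    have "t \<in> S a" "t \<in> S b" using that z by auto
    then show ?thesis by (simp add: g_def cutoff_def)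
  qed
  have pt: "W x * ennreal (\<bar>prim f x - prim g x\<bar> powr p) * indicator I x \<le>
      k * (V x * indicator (S a) x + V x * indicator (I - S b) x
        + (W x * ennreal A * indicator (S a' - S a) x + W x * ennreal B * indicator (S b' - S b) x))"
    (is "_ \<le> ?rhs x") for x
  proof (cases "x \<in> I")
    case x: True
    define u1 u2 u3 u4 where "u1 = \<bar>prim f x\<bar> * indicator (S a) x"
      and "u2 = \<bar>prim f x\<bar> * indicator (I - S b) x"
      and "u3 = \<bar>prim f a\<bar> * indicator (S a' - S a) x"
      and "u4 = \<bar>prim f b\<bar> * indicator (S b' - S b) x"
    have u: "0 \<le> u1" "0 \<le> u2" "0 \<le> u3" "0 \<le> u4" by (auto simp: u1_def u2_def u3_def u4_def)
    have "\<bar>prim f x - prim g x\<bar> \<le> (u1 + u2) + (u3 + u4)"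
      using prim_cutoff[OF f a(1) a'(1) x a'(2,3)] prim_cutoff[OF f b(1) b'(1) x b'(2,3)] x
      unfolding prim_g[OF x] u1_def u2_def u3_def u4_def
      by (auto simp: indicator_def of_bool_def split: if_splits)
    then have "\<bar>prim f x - prim g x\<bar> powr p \<le> ((u1 + u2) + (u3 + u4)) powr p"
      using p by (intro powr_mono2) auto
    also have "\<dots> \<le> 2 powr p * ((u1 + u2) powr p + (u3 + u4) powr p)"
      using u p by (intro powr_add_le) auto
    also have "\<dots> \<le> 2 powr p * (2 powr p * (u1 powr p + u2 powr p) + 2 powr p * (u3 powr p + u4 powr p))"
      using u p by (intro mult_left_mono add_mono powr_add_le) auto
    also have "\<dots> = 4 powr p * (u1 powr p + u2 powr p + (u3 powr p + u4 powr p))"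
      by (simp add: algebra_simps flip: powr_mult)
    finally have "W x * ennreal (\<bar>prim f x - prim g x\<bar> powr p)
        \<le> W x * ennreal (4 powr p * (u1 powr p + u2 powr p + (u3 powr p + u4 powr p)))"
      by (intro mult_left_mono ennreal_leI) auto
    also have "\<dots> = k * (W x * ennreal (u1 powr p) + W x * ennreal (u2 powr p)
        + (W x * ennreal (u3 powr p) + W x * ennreal (u4 powr p)))"
      by (simp add: k_def ennreal_mult distrib_left mult_ac)
    also have "\<dots> = ?rhs x"
      using p x by (auto simp: u1_def u2_def u3_def u4_def V_eq A_def B_def indicator_def)
    finally show ?thesis using x by simp
  qed auto
  have "(\<integral>\<^sup>+x\<in>I. W x * ennreal (\<bar>prim f x - prim g x\<bar> powr p) \<partial>M) \<le> (\<integral>\<^sup>+x. ?rhs x \<partial>M)"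
    by (rule nn_integral_mono) (rule pt)
  also have "\<dots> = k * (((\<integral>\<^sup>+x\<in>S a. V x \<partial>M) + (\<integral>\<^sup>+x\<in>I - S b. V x \<partial>M))
      + ((\<integral>\<^sup>+x\<in>S a' - S a. W x * ennreal A \<partial>M) + (\<integral>\<^sup>+x\<in>S b' - S b. W x * ennreal B \<partial>M)))"
    by (simp add: nn_integral_cmult nn_integral_add)
  also have "\<dots> < k * ((r + r) + (r + r))"
    using k a(2) b(2) a'(4) b'(4) 
    by (intro ennreal_mult_strict_left_mono add_strict_mono) (auto simp: less_top zero_less_iff_neq_zero)
  also have "\<dots> = (4 * k) * r" by (simp add: mult_ac flip: distrib_left mult_2)
  also have "\<dots> \<le> e" 
  proof -
    have "4 * k * r = e * (4 * k) / (4 * k)"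
      by (simp add: r_def ennreal_times_divide mult.commute)
    also have "\<dots> = e" using k by (intro ennreal_mult_divide_eq) (auto simp: ennreal_mult_eq_top_iff)
    finally show ?thesis by simp
  qed
  finally show ?thesis using that[OF g_meas z(1) g_int g_zero] by blast
qed

end

section \<open>Segments of an interval\<close>

lemma sets_joint_segment:
  "{z \<in> space (lebesgue \<Otimes>\<^sub>M lebesgue). fst z \<in> einterval c d \<and> snd z \<in> I_seg c d \<nu> (fst z)}
    \<in> sets (lebesgue \<Otimes>\<^sub>M lebesgue)"
proof -
  have id: "(\<lambda>x::real. x) \<in> borel_measurable lebesgue" by (auto intro: measurable_completion)
  have [measurable]: "(\<lambda>z::real \<times> real. fst z) \<in> borel_measurable (lebesgue \<Otimes>\<^sub>M lebesgue)"
    "(\<lambda>z::real \<times> real. snd z) \<in> borel_measurable (lebesgue \<Otimes>\<^sub>M lebesgue)"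
    using measurable_compose[OF measurable_fst id] measurable_compose[OF measurable_snd id] by auto
  show ?thesis
    by (cases "\<nu> = 1") (simp_all add: I_seg_def einterval_def)
qed

lemma tendsto_const_div_Suc: "(\<lambda>n. (k::real) / real (Suc n)) \<longlonglongrightarrow> 0"
  using tendsto_mult[OF tendsto_const[of k] LIMSEQ_inverse_real_of_nat]
  by (simp add: divide_inverse)

lemma segment_chain_left:
  assumes "c < d"
  shows "segment_chain lebesgue (einterval c d) (I_seg c d 1)"
proof -
  interpret sigma_finite_measure "lebesgue :: real measure" by (rule sigma_finite_lebesgue)
  have below: "ereal s < d" if "s \<le> t" "ereal t < d" for s t
    using that by (meson ereal_less_eq(3) order.strict_trans1)
  show ?thesis
  proof
    show "\<exists>a :: nat \<Rightarrow> real. range a \<subseteq> einterval c d \<and> decseq (\<lambda>n. I_seg c d 1 (a n))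
        \<and> (\<Inter>n. I_seg c d 1 (a n)) = {}"
    proof -
      obtain X :: "nat \<Rightarrow> real" where X: "decseq X" "\<And>i. c < X i" "\<And>i. X i < d" "X \<longlonglongrightarrow> c"
        using ereal_decseq_approx[OF assms] by blast
      have "\<exists>n. X n < t" if "c < ereal t" for t
        using order_tendstoD(2)[OF X(4) that] by (auto simp: eventually_sequentially)
      then have "\<exists>n. t \<notin> I_seg c d 1 (X n)" for t
        by (cases "c < ereal t") (simp_all add: I_seg_def not_le)
      then have "(\<Inter>n. I_seg c d 1 (X n)) = {}" by blast
      moreover have "decseq (\<lambda>n. I_seg c d 1 (X n))"
        using X(1) unfolding decseq_def I_seg_def by (auto intro: order_trans)
      ultimately show ?thesis using X(2,3) by (intro exI[of _ X]) (auto simp: einterval_def)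
    qed
    show "\<exists>b :: nat \<Rightarrow> real. range b \<subseteq> einterval c d \<and> incseq (\<lambda>n. I_seg c d 1 (b n))
        \<and> (\<Union>n. I_seg c d 1 (b n)) = einterval c d"
    proof -
      obtain X :: "nat \<Rightarrow> real" where X: "incseq X" "\<And>i. c < X i" "\<And>i. X i < d" "X \<longlonglongrightarrow> d"
        using ereal_incseq_approx[OF assms] by blast
      have "\<exists>n. t \<le> X n" if "ereal t < d" for t
        using order_tendstoD(1)[OF X(4) that] by (auto simp: eventually_sequentially intro: less_imp_le)
      moreover have "t < d" if "t \<le> X n" for t n
        using that X(3)[of n] by (rule below)
      ultimately have "(\<Union>n. I_seg c d 1 (X n)) = einterval c d"
        by (auto simp: I_seg_def einterval_def)
      moreover have "incseq (\<lambda>n. I_seg c d 1 (X n))"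
        using X(1) unfolding incseq_def I_seg_def by (auto intro: order_trans)
      ultimately show ?thesis using X(2,3) by (intro exI[of _ X]) (auto simp: einterval_def)
    qed
    show "\<exists>y :: nat \<Rightarrow> real. range y \<subseteq> einterval c d \<and> decseq (\<lambda>n. I_seg c d 1 (y n)) \<and>
        (\<Inter>n. I_seg c d 1 (y n)) = I_seg c d 1 x \<and>
        (\<forall>n. 0 < emeasure lebesgue (I_seg c d 1 (y n) - I_seg c d 1 x) \<and>
             emeasure lebesgue (I_seg c d 1 (y n) - I_seg c d 1 x) < \<infinity>)"
      if x: "x \<in> einterval c d" for x
    proof -
      obtain z where z: "x < z" "ereal z < d" using x ereal_dense2[of x d] by (auto simp: einterval_def)
      define y where "y n = x + (z - x) / real (Suc n)" for n
      have y: "x < y n" "y n \<le> z" for n using z by (auto simp: y_def field_simps intro: mult_right_mono)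
      have yd: "y n < d" for n using y(2)[of n] z(2) by (rule below)
      have cx: "c < t" if "x < t" for t using x that less_trans[of c "ereal x" "ereal t"] by (auto simp: einterval_def)
      have "y \<longlonglongrightarrow> x + 0" unfolding y_def[abs_def] by (intro tendsto_add tendsto_const tendsto_const_div_Suc)
      then have "t \<le> x" if "\<forall>n. t \<le> y n" for t
        using that LIMSEQ_le_const[of y "x + 0" t] by simp
      moreover have "t \<le> y n" if "t \<le> x" for t n using that y(1)[of n] by simp
      ultimately have "(\<forall>n. t \<le> y n) \<longleftrightarrow> t \<le> x" for t by blast
      then have "(\<Inter>n. I_seg c d 1 (y n)) = I_seg c d 1 x"
        by (auto simp: I_seg_def)
      moreover have "decseq y"
        using z unfolding y_def[abs_def] decseq_def by (auto intro!: divide_left_mono)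
      then have "decseq (\<lambda>n. I_seg c d 1 (y n))"
        unfolding decseq_def I_seg_def by (auto intro: order_trans)
      moreover have "I_seg c d 1 (y n) - I_seg c d 1 x = {x<..y n}" for n
        using cx by (auto simp: I_seg_def)
      moreover have "range y \<subseteq> einterval c d" using cx y yd by (auto simp: einterval_def)
      ultimately show ?thesis using y by (intro exI[of _ y]) (auto simp: less_imp_le)
    qed
  qed (use sets_joint_segment[of c d 1] in \<open>auto simp: I_seg_def einterval_def intro: below\<close>)
qed

lemma segment_chain_right:
  assumes "c < d"
  shows "segment_chain lebesgue (einterval c d) (I_seg c d 2)"
proof -
  interpret sigma_finite_measure "lebesgue :: real measure" by (rule sigma_finite_lebesgue)
  have above: "c < ereal t" if "s \<le> t" "c < ereal s" for s t
    using that by (meson ereal_less_eq(3) order.strict_trans2)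
  show ?thesis
  proof
    show "\<exists>a :: nat \<Rightarrow> real. range a \<subseteq> einterval c d \<and> decseq (\<lambda>n. I_seg c d 2 (a n))
        \<and> (\<Inter>n. I_seg c d 2 (a n)) = {}"
    proof -
      obtain X :: "nat \<Rightarrow> real" where X: "incseq X" "\<And>i. c < X i" "\<And>i. X i < d" "X \<longlonglongrightarrow> d"
        using ereal_incseq_approx[OF assms] by blast
      have "\<exists>n. t < X n" if "ereal t < d" for t
        using order_tendstoD(1)[OF X(4) that] by (auto simp: eventually_sequentially)
      then have "\<exists>n. t \<notin> I_seg c d 2 (X n)" for t
        by (cases "ereal t < d") (simp_all add: I_seg_def not_le)
      then have "(\<Inter>n. I_seg c d 2 (X n)) = {}" by blast
      moreover have "decseq (\<lambda>n. I_seg c d 2 (X n))"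
        using X(1) unfolding decseq_def incseq_def I_seg_def by (auto intro: order_trans)
      ultimately show ?thesis using X(2,3) by (intro exI[of _ X]) (auto simp: einterval_def)
    qed
    show "\<exists>b :: nat \<Rightarrow> real. range b \<subseteq> einterval c d \<and> incseq (\<lambda>n. I_seg c d 2 (b n))
        \<and> (\<Union>n. I_seg c d 2 (b n)) = einterval c d"
    proof -
      obtain X :: "nat \<Rightarrow> real" where X: "decseq X" "\<And>i. c < X i" "\<And>i. X i < d" "X \<longlonglongrightarrow> c"
        using ereal_decseq_approx[OF assms] by blast
      have "\<exists>n. X n \<le> t" if "c < ereal t" for t
        using order_tendstoD(2)[OF X(4) that] by (auto simp: eventually_sequentially intro: less_imp_le)
      moreover have "c < t" if "X n \<le> t" for t n
        using that X(2)[of n] by (rule above)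
      ultimately have "(\<Union>n. I_seg c d 2 (X n)) = einterval c d"
        by (auto simp: I_seg_def einterval_def)
      moreover have "incseq (\<lambda>n. I_seg c d 2 (X n))"
        using X(1) unfolding decseq_def incseq_def I_seg_def by (auto intro: order_trans)
      ultimately show ?thesis using X(2,3) by (intro exI[of _ X]) (auto simp: einterval_def)
    qed
    show "\<exists>y :: nat \<Rightarrow> real. range y \<subseteq> einterval c d \<and> decseq (\<lambda>n. I_seg c d 2 (y n)) \<and>
        (\<Inter>n. I_seg c d 2 (y n)) = I_seg c d 2 x \<and>
        (\<forall>n. 0 < emeasure lebesgue (I_seg c d 2 (y n) - I_seg c d 2 x) \<and>
             emeasure lebesgue (I_seg c d 2 (y n) - I_seg c d 2 x) < \<infinity>)"
      if x: "x \<in> einterval c d" for x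
    proof -
      obtain z where z: "c < ereal z" "z < x" using x ereal_dense2[of c x] by (auto simp: einterval_def)
      define y where "y n = x - (x - z) / real (Suc n)" for n
      have y: "y n < x" "z \<le> y n" for n using z by (auto simp: y_def field_simps intro: mult_right_mono)
      have yc: "c < y n" for n using y(2)[of n] z(1) by (rule above)
      have xd: "t < d" if "t < x" for t using x that less_trans[of "ereal t" "ereal x" d] by (auto simp: einterval_def)
      have "y \<longlonglongrightarrow> x - 0" unfolding y_def[abs_def] by (intro tendsto_diff tendsto_const tendsto_const_div_Suc)
      then have "x \<le> t" if "\<forall>n. y n \<le> t" for t
        using that LIMSEQ_le_const2[of y "x - 0" t] by simp
      moreover have "y n \<le> t" if "x \<le> t" for t n using that y(1)[of n] by simp
      ultimately have "(\<forall>n. y n \<le> t) \<longleftrightarrow> x \<le> t" for t by blast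
      then have "(\<Inter>n. I_seg c d 2 (y n)) = I_seg c d 2 x"
        by (auto simp: I_seg_def)
      moreover have "incseq y"
        using z unfolding y_def[abs_def] incseq_def by (auto intro!: divide_left_mono)
      then have "decseq (\<lambda>n. I_seg c d 2 (y n))"
        unfolding decseq_def incseq_def I_seg_def by (auto intro: order_trans)
      moreover have "I_seg c d 2 (y n) - I_seg c d 2 x = {y n..<x}" for n
        using xd by (auto simp: I_seg_def)
      moreover have "range y \<subseteq> einterval c d" using xd y yc by (auto simp: einterval_def)
      ultimately show ?thesis using y by (intro exI[of _ y]) (auto simp: less_imp_le)
    qed
  qed (use sets_joint_segment[of c d 2] in \<open>auto simp: I_seg_def einterval_def intro: above\<close>)
qed

section \<open>The Cesaro-Copson spaces\<close>

lemma measurable_real_part: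
  assumes "f \<in> meas_fun c d"
  shows "(\<lambda>t. indicator (einterval c d) t * real_of_ereal (f t)) \<in> borel_measurable lebesgue"
proof -
  have "(\<lambda>t. real_of_ereal (f t)) \<in> borel_measurable (lebesgue_on (einterval c d))"
    using assms unfolding meas_fun_def by measurable
  then show ?thesis by (simp add: borel_measurable_restrict_space_iff)
qed

lemma measurable_ennreal_part:
  assumes "f \<in> meas_fun c d" and [measurable]: "\<phi> \<in> borel_measurable borel"
  shows "(\<lambda>t. (\<phi> (f t) :: ennreal) * indicator (einterval c d) t) \<in> borel_measurable lebesgue"
proof -
  have "(\<lambda>t. \<phi> (f t)) \<in> borel_measurable (lebesgue_on (einterval c d))"
    using assms(1) unfolding meas_fun_def by measurable
  then show ?thesis by (simp add: borel_measurable_restrict_space_iff_ennreal)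
qed

context
  fixes c d :: ereal and \<nu> :: nat
  assumes cd: "c < d" and \<nu>: "\<nu> \<in> {1, 2}"
begin

interpretation segment_chain lebesgue "einterval c d" "I_seg c d \<nu>"
  using segment_chain_left[OF cd] segment_chain_right[OF cd] \<nu> by auto

lemma locally_integrable_finite_AE:
  assumes "f \<in> L1_loc_1 c d \<nu>"
  shows "AE t in lebesgue. t \<in> einterval c d \<longrightarrow> \<bar>f t\<bar> \<noteq> \<infinity>"
proof -
  have fm: "f \<in> meas_fun c d" using assms by (simp add: L1_loc_1_def)
  obtain b :: "nat \<Rightarrow> real" where b: "range b \<subseteq> einterval c d" "(\<Union>n. I_seg c d \<nu> (b n)) = einterval c d"
    using seg_to_all by blast
  have "AE t in lebesgue. t \<in> I_seg c d \<nu> (b n) \<longrightarrow> \<bar>f t\<bar> \<noteq> \<infinity>" for n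
  proof -
    have bn: "b n \<in> einterval c d" using b by auto
    note [measurable] = seg_sets[OF bn] measurable_ennreal_part[OF fm, of "\<lambda>x. e2ennreal \<bar>x\<bar>"]
    have eq: "e2ennreal \<bar>f t\<bar> * indicator (I_seg c d \<nu> (b n)) t = 
        e2ennreal \<bar>f t\<bar> * indicator (einterval c d) t * indicator (I_seg c d \<nu> (b n)) t" for t
      using seg_subset[OF bn] by (auto simp: indicator_def)
    have "AE t in lebesgue. e2ennreal \<bar>f t\<bar> * indicator (I_seg c d \<nu> (b n)) t \<noteq> \<infinity>"
    proof (rule nn_integral_PInf_AE)
      show "(\<lambda>t. e2ennreal \<bar>f t\<bar> * indicator (I_seg c d \<nu> (b n)) t) \<in> borel_measurable lebesgue"
        unfolding eq by measurable
      show "(\<integral>\<^sup>+t\<in>I_seg c d \<nu> (b n). e2ennreal \<bar>f t\<bar> \<partial>lebesgue) \<noteq> \<infinity>"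
        using assms bn by (auto simp: L1_loc_1_def)
    qed
    then show ?thesis by eventually_elim auto
  qed
  then have "AE t in lebesgue. \<forall>n. t \<in> I_seg c d \<nu> (b n) \<longrightarrow> \<bar>f t\<bar> \<noteq> \<infinity>"
    unfolding AE_all_countable by simp
  then show ?thesis
  proof eventually_elim
    case (elim t)
    show ?case
    proof
      assume "t \<in> einterval c d"
      then obtain n where n: "t \<in> I_seg c d \<nu> (b n)" using b(2) by auto
      show "\<bar>f t\<bar> \<noteq> \<infinity>" by (rule elim[rule_format, OF n])
    qed
  qed
qed

lemma real_part_integrable:
  assumes "f \<in> L1_loc_1 c d \<nu>" and x: "x \<in> einterval c d"
  defines "fr \<equiv> \<lambda>t. indicator (einterval c d) t * real_of_ereal (f t)"
  shows "set_integrable lebesgue (I_seg c d \<nu> x) fr"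
    and "ennreal \<bar>prim fr x\<bar> \<le> (\<integral>\<^sup>+t\<in>I_seg c d \<nu> x. e2ennreal \<bar>f t\<bar> \<partial>lebesgue)"
proof -
  have [measurable]: "fr \<in> borel_measurable lebesgue"
    using assms(1) unfolding fr_def by (intro measurable_real_part) (simp add: L1_loc_1_def)
  note [measurable] = seg_sets[OF x]
  let ?h = "\<lambda>t. indicator (I_seg c d \<nu> x) t *\<^sub>R fr t"
  have "ennreal (norm (?h t)) \<le> e2ennreal \<bar>f t\<bar> * indicator (I_seg c d \<nu> x) t" for t
    by (cases "f t") (auto simp: fr_def indicator_def)
  then have le: "(\<integral>\<^sup>+t. ennreal (norm (?h t)) \<partial>lebesgue) \<le> (\<integral>\<^sup>+t\<in>I_seg c d \<nu> x. e2ennreal \<bar>f t\<bar> \<partial>lebesgue)"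
    by (rule nn_integral_mono)
  also have "\<dots> < \<infinity>" using assms(1) x by (auto simp: L1_loc_1_def)
  finally have int: "integrable lebesgue ?h" by (intro integrableI_bounded) auto
  then show "set_integrable lebesgue (I_seg c d \<nu> x) fr" by (simp add: set_integrable_def)
  have "ennreal (norm (prim fr x)) \<le> (\<integral>\<^sup>+t. ennreal (norm (?h t)) \<partial>lebesgue)"
    unfolding prim_def set_lebesgue_integral_def by (rule integral_norm_bound_ennreal[OF int])
  with le show "ennreal \<bar>prim fr x\<bar> \<le> (\<integral>\<^sup>+t\<in>I_seg c d \<nu> x. e2ennreal \<bar>f t\<bar> \<partial>lebesgue)" by simp
qed

lemma segment_integral_eq_prim:
  assumes "x \<in> einterval c d"
  shows "(LINT t:I_seg c d \<nu> x|lebesgue. f t)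
    = prim (\<lambda>t. indicator (einterval c d) t * f t) x"
  unfolding prim_def
  using seg_sets[OF assms] seg_subset[OF assms]
  by (intro set_lebesgue_integral_cong) (auto simp: indicator_def)

text \<open>
  Only local integrability takes an argument. If \<open>J x\<close>, the integral of \<open>\<bar>f\<bar>\<close> over the segment of
  \<open>x\<close>, were infinite, then \<open>J\<close> would be infinite at all later points, since the segments grow.
  These points include a set of positive measure, and as \<open>w > 0\<close> a.e. the norm of \<open>f\<close>
  would be infinite.
\<close>

lemma Cs_subset_Ch:
  assumes p: "0 < p" and w: "AE x in lebesgue. x \<in> einterval c d \<longrightarrow> 0 < w x"
  shows "Cs c d \<nu> p w \<subseteq> Ch c d \<nu> p w"
proof
  fix f assume "f \<in> Cs c d \<nu> p w"
  define J where "J x = (\<integral>\<^sup>+t\<in>I_seg c d \<nu> x. e2ennreal \<bar>f t\<bar> \<partial>lebesgue)" for x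
  have fm: "f \<in> meas_fun c d"
    and fin: "(\<integral>\<^sup>+x\<in>einterval c d. epowr (e2ennreal (w x) * J x) p \<partial>lebesgue) < top"
    using \<open>f \<in> Cs c d \<nu> p w\<close> by (auto simp: Cs_def Cs_norm_def J_def)
  have J_mono: "J x \<le> J y" if "x \<in> I_seg c d \<nu> y" "x \<in> einterval c d" "y \<in> einterval c d" for x y
    unfolding J_def using seg_mono[OF that(2,3,1)]
    by (intro nn_integral_mono) (auto simp: indicator_def)
  have "J x < \<infinity>" if x: "x \<in> einterval c d" for x
  proof (rule ccontr)
    assume "\<not> J x < \<infinity>"
    then have Jx: "J x = top" by (simp add: less_top[symmetric])
    obtain y where y: "y \<in> einterval c d" "0 < emeasure lebesgue (I_seg c d \<nu> y - I_seg c d \<nu> x)"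
      using seg_right_cont[OF x] by blast
    let ?D = "I_seg c d \<nu> y - I_seg c d \<nu> x"
    have D: "?D \<in> sets lebesgue" using seg_sets[OF x] seg_sets[OF y(1)] by auto
    have "AE t in lebesgue. top * indicator ?D t
        \<le> epowr (e2ennreal (w t) * J t) p * indicator (einterval c d) t"
      using w
    proof eventually_elim
      case (elim t)
      show ?case
      proof (cases "t \<in> ?D")
        case True
        then have t: "t \<in> einterval c d" using seg_subset[OF y(1)] by auto
        then have "J x \<le> J t" using True J_mono[OF seg_total[OF t x] x t] by auto
        then have "J t = top" using Jx by (simp add: top_unique)
        moreover have "e2ennreal (w t) \<noteq> 0" using elim t by (cases "w t") auto
        ultimately show ?thesis using t by (simp add: ennreal_mult_top epowr_def)
      qed simp
    qed
    then have "(\<integral>\<^sup>+t. top * indicator ?D t \<partial>lebesgue)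
        \<le> (\<integral>\<^sup>+x\<in>einterval c d. epowr (e2ennreal (w x) * J x) p \<partial>lebesgue)"
      by (rule nn_integral_mono_AE)
    moreover have "(\<integral>\<^sup>+t. top * indicator ?D t \<partial>lebesgue) = top"
      using D y(2) by (subst nn_integral_cmult_indicator) (auto simp: ennreal_top_mult simp del: emeasure_completion)
    ultimately show False using fin by (simp add: top_unique)
  qed
  then have f1: "f \<in> L1_loc_1 c d \<nu>" using fm by (simp add: L1_loc_1_def J_def)
  have "(\<integral>\<^sup>+x\<in>einterval c d. epowr (e2ennreal \<bar>w x * ereal (LINT t:I_seg c d \<nu> x|lebesgue. real_of_ereal (f t))\<bar>) p
      \<partial>lebesgue) \<le> (\<integral>\<^sup>+x\<in>einterval c d. epowr (e2ennreal (w x) * J x) p \<partial>lebesgue)"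
  proof (rule nn_integral_mono_AE)
    show "AE x in lebesgue. epowr (e2ennreal \<bar>w x * ereal (LINT t:I_seg c d \<nu> x|lebesgue. real_of_ereal (f t))\<bar>) p
        * indicator (einterval c d) x
      \<le> epowr (e2ennreal (w x) * J x) p * indicator (einterval c d) x"
      using w
    proof eventually_elim
      case (elim x)
      show ?case
      proof (cases "x \<in> einterval c d")
        case True
        with elim p real_part_integrable(2)[OF f1 True] show ?thesis
          by (auto simp: e2ennreal_abs_mult segment_integral_eq_prim J_def
              intro!: epowr_mono mult_left_mono)
      qed simp
    qed
  qed
  with fin f1 show "f \<in> Ch c d \<nu> p w" by (auto simp: Ch_def Ch_norm_def)
qed

text \<open>The difference is formed in the extended reals, where \<open>real_of_ereal\<close> is not additive at infinite
  values of \<open>f\<close>. These form a null set because \<open>f\<close> is locally integrable.\<close>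

lemma prim_difference:
  assumes f: "f \<in> L1_loc_1 c d \<nu>" and g: "g \<in> borel_measurable lebesgue"
    "set_integrable lebesgue (einterval c d) g" and x: "x \<in> einterval c d"
  shows "(LINT t:I_seg c d \<nu> x|lebesgue. real_of_ereal (f t - ereal (g t)))
    = prim (\<lambda>t. indicator (einterval c d) t * real_of_ereal (f t)) x - prim g x"
proof -
  have fm: "f \<in> meas_fun c d" using f by (simp add: L1_loc_1_def)
  have "(\<lambda>t. f t - ereal (g t)) \<in> meas_fun c d"
    using fm measurable_restrict_space1[OF g(1), of "einterval c d"] unfolding meas_fun_def by measurable
  note [measurable] = measurable_real_part[OF this] measurable_real_part[OF fm] g(1)
  have "(LINT t:I_seg c d \<nu> x|lebesgue. real_of_ereal (f t - ereal (g t)))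
      = (LINT t:I_seg c d \<nu> x|lebesgue. indicator (einterval c d) t * real_of_ereal (f t - ereal (g t)))"
    using segment_integral_eq_prim[OF x] by (simp add: prim_def)
  also have "\<dots> = (LINT t:I_seg c d \<nu> x|lebesgue. indicator (einterval c d) t * real_of_ereal (f t) - g t)"
  proof (rule set_lebesgue_integral_cong_AE)
    show "AE t\<in>I_seg c d \<nu> x in lebesgue. indicator (einterval c d) t * real_of_ereal (f t - ereal (g t))
        = indicator (einterval c d) t * real_of_ereal (f t) - g t"
      using locally_integrable_finite_AE[OF f]
    proof eventually_elim
      case (elim t)
      then show ?case using seg_subset[OF x] by (cases "f t") auto
    qed
  qed (use seg_sets[OF x] in measurable)
  also have "\<dots> = prim (\<lambda>t. indicator (einterval c d) t * real_of_ereal (f t)) x - prim g x"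
    unfolding prim_def
    using real_part_integrable(1)[OF f x] set_integrable_subset[OF g(2) seg_sets[OF x] seg_subset[OF x]]
    by (rule set_integral_diff(2))
  finally show ?thesis .
qed

text \<open>The integral of \<open>\<bar>g\<bar>\<close> over any segment is at most the finite constant \<open>C\<close>, the
  integral over the whole interval, and it vanishes at the points of the segment of \<open>z\<close>, beyond which
  \<open>w\<^sup>p\<close> is integrable.\<close>

lemma integrable_truncation_in_Cs:
  assumes g [measurable]: "g \<in> borel_measurable lebesgue" and gi: "set_integrable lebesgue (einterval c d) g"
    and z: "z \<in> einterval c d" and gz: "\<And>t. t \<in> I_seg c d \<nu> z \<Longrightarrow> g t = 0"
    and wm: "w \<in> meas_fun c d"
    and tail: "(\<integral>\<^sup>+x\<in>einterval c d - I_seg c d \<nu> z. epowr (e2ennreal (w x)) p \<partial>lebesgue) < \<infinity>"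
    and p: "0 < p"
  shows "(\<lambda>t. ereal (g t)) \<in> Cs c d \<nu> p w"
proof -
  define C where "C = (\<integral>\<^sup>+t. ennreal (norm (indicator (einterval c d) t *\<^sub>R g t)) \<partial>lebesgue)"
  define J where "J x = (\<integral>\<^sup>+t\<in>I_seg c d \<nu> x. e2ennreal \<bar>ereal (g t)\<bar> \<partial>lebesgue)" for x
  have C: "C < \<infinity>"
    using gi unfolding set_integrable_def C_def by (simp add: integrable_iff_bounded)
  have JC: "J x \<le> C" if "x \<in> einterval c d" for x
    unfolding J_def C_def using seg_subset[OF that]
    by (intro nn_integral_mono) (auto simp: indicator_def)
  have J0: "J x = 0" if "x \<in> einterval c d" "x \<in> I_seg c d \<nu> z" for x
  proof -
    have "(\<lambda>t. e2ennreal \<bar>ereal (g t)\<bar> * indicator (I_seg c d \<nu> x) t) = (\<lambda>t. 0)"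
      using seg_mono[OF that(1) z that(2)] gz by (auto simp: indicator_def fun_eq_iff zero_ereal_def[symmetric])
    then show ?thesis by (simp add: J_def)
  qed
  let ?D = "einterval c d - I_seg c d \<nu> z"
  note [measurable] = seg_sets[OF z]
  have [measurable]: "(\<lambda>x. epowr (e2ennreal (w x)) p * indicator (einterval c d) x) \<in> borel_measurable lebesgue"
    by (rule measurable_ennreal_part[OF wm]) measurable
  have eqD: "epowr (e2ennreal (w x)) p * indicator ?D x
      = epowr (e2ennreal (w x)) p * indicator (einterval c d) x * indicator ?D x" for x
    by (auto simp: indicator_def)
  have "(\<integral>\<^sup>+x\<in>einterval c d. epowr (e2ennreal (w x) * J x) p \<partial>lebesgue)
      \<le> (\<integral>\<^sup>+x. epowr C p * (epowr (e2ennreal (w x)) p * indicator ?D x) \<partial>lebesgue)"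
  proof (rule nn_integral_mono)
    fix x
    show "epowr (e2ennreal (w x) * J x) p * indicator (einterval c d) x
        \<le> epowr C p * (epowr (e2ennreal (w x)) p * indicator ?D x)"
    proof (cases "x \<in> ?D")
      case True
      then have "e2ennreal (w x) * J x \<le> C * e2ennreal (w x)"
        using JC by (subst mult.commute) (intro mult_right_mono, auto)
      with True p show ?thesis by (simp add: epowr_mono flip: epowr_mult)
    next
      case False
      then show ?thesis
        using J0 p by (cases "x \<in> einterval c d") (auto simp: epowr_ennreal[of 0, simplified])
    qed
  qed
  also have "\<dots> = epowr C p * (\<integral>\<^sup>+x\<in>?D. epowr (e2ennreal (w x)) p \<partial>lebesgue)"
    unfolding eqD by (rule nn_integral_cmult) measurable
  also have "\<dots> < top" using C tail by (simp add: ennreal_mult_less_top)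
  finally show ?thesis
    using measurable_restrict_space1[OF g, of "einterval c d"]
    by (auto simp: Cs_def Cs_norm_def J_def meas_fun_def)
qed

end

theorem corollary2p1:
  fixes c d :: ereal and p :: real and \<nu> :: nat and w :: "real \<Rightarrow> ereal"
  assumes "c < d"
    and "1 < p"
    and "\<nu> \<in> {1, 2}"
    and "w \<in> meas_fun c d"
    and "AE x in lebesgue_on (einterval c d). 0 < w x"
    and "(\<lambda>x. enn2ereal (epowr (e2ennreal (w x)) p)) \<in> L1_loc_2 c d \<nu>"
  shows "dense_wrt (Ch_norm c d \<nu> p w) (Cs c d \<nu> p w) (Ch c d \<nu> p w)"
proof -
  interpret segment_chain lebesgue "einterval c d" "I_seg c d \<nu>"
    using segment_chain_left[OF assms(1)] segment_chain_right[OF assms(1)] assms(3) by auto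
  let ?I = "einterval c d" and ?S = "I_seg c d \<nu>"
  have p: "0 < p" using assms(2) by simp
  have w_pos: "AE x in lebesgue. x \<in> ?I \<longrightarrow> 0 < w x"
    using assms(5) by (simp add: AE_restrict_space_iff)
  define W where "W x = epowr (e2ennreal (w x)) p * indicator ?I x" for x
  have W: "W \<in> borel_measurable lebesgue"
    unfolding W_def[abs_def] by (rule measurable_ennreal_part[OF assms(4)]) measurable
  have tail: "(\<integral>\<^sup>+t\<in>?I - ?S x. epowr (e2ennreal (w t)) p \<partial>lebesgue) < \<infinity>" if x: "x \<in> ?I" for x
  proof -
    have "?I - ?S x \<subseteq> I_seg_star c d \<nu> x"
      by (auto simp: I_seg_def I_seg_star_def einterval_def)
    then have "(\<integral>\<^sup>+t\<in>?I - ?S x. epowr (e2ennreal (w t)) p \<partial>lebesgue)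
        \<le> (\<integral>\<^sup>+t\<in>I_seg_star c d \<nu> x. e2ennreal \<bar>enn2ereal (epowr (e2ennreal (w t)) p)\<bar> \<partial>lebesgue)"
      by (intro nn_integral_mono) (auto simp: indicator_def abs_ereal_pos)
    also have "\<dots> < \<infinity>" using assms(6) x by (simp add: L1_loc_2_def)
    finally show ?thesis .
  qed
  have tail_W: "(\<integral>\<^sup>+t\<in>?I - ?S x. W t \<partial>lebesgue) < \<infinity>" if x: "x \<in> ?I" for x
    by (rule order.strict_trans1[OF nn_integral_mono tail[OF x]]) (auto simp: W_def indicator_def)
  have norm_eq: "(\<integral>\<^sup>+x\<in>?I. epowr (e2ennreal \<bar>w x * ereal (F x)\<bar>) p \<partial>lebesgue)
      = (\<integral>\<^sup>+x\<in>?I. W x * ennreal (\<bar>G x\<bar> powr p) \<partial>lebesgue)" if "\<And>x. x \<in> ?I \<Longrightarrow> F x = G x" for F G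
  proof (rule nn_integral_cong_AE)
    show "AE x in lebesgue. epowr (e2ennreal \<bar>w x * ereal (F x)\<bar>) p * indicator ?I x
        = W x * ennreal (\<bar>G x\<bar> powr p) * indicator ?I x"
      using w_pos
    proof eventually_elim
      case (elim x)
      then show ?case
        using that[of x] p by (cases "x \<in> ?I") (simp_all add: W_def epowr_weight_mult)
    qed
  qed
  have "\<exists>g\<in>Cs c d \<nu> p w. Ch_norm c d \<nu> p w (\<lambda>x. f x - g x) < ennreal \<epsilon>"
    if f: "f \<in> Ch c d \<nu> p w" and \<epsilon>: "0 < \<epsilon>" for f and \<epsilon> :: real
  proof -
    define fr where "fr t = indicator ?I t * real_of_ereal (f t)" for t
    have f1: "f \<in> L1_loc_1 c d \<nu>" using f by (simp add: Ch_def)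
    have fr: "fr \<in> borel_measurable lebesgue"
      unfolding fr_def[abs_def] using f1 by (intro measurable_real_part) (simp add: L1_loc_1_def)
    have fr_int: "set_integrable lebesgue (?S x) fr" if "x \<in> ?I" for x
      unfolding fr_def[abs_def] by (rule real_part_integrable(1)[OF assms(1,3) f1 that])
    have fin: "(\<integral>\<^sup>+x\<in>?I. W x * ennreal (\<bar>prim fr x\<bar> powr p) \<partial>lebesgue) < \<infinity>"
      using f norm_eq[of "\<lambda>x. LINT t:?S x|lebesgue. real_of_ereal (f t)" "prim fr"]
        segment_integral_eq_prim[OF assms(1,3)]
      by (simp add: Ch_def Ch_norm_def fr_def[abs_def])
    obtain g z where g: "g \<in> borel_measurable lebesgue" "z \<in> ?I" "set_integrable lebesgue ?I g"
      "\<And>t. t \<in> ?S z \<Longrightarrow> g t = 0"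
      "(\<integral>\<^sup>+x\<in>?I. W x * ennreal (\<bar>prim fr x - prim g x\<bar> powr p) \<partial>lebesgue) < ennreal (\<epsilon> powr p)"
      by (rule cutoff_approximation[OF W tail_W fr fr_int fin p, of "ennreal (\<epsilon> powr p)"])
        (use \<epsilon> in auto)
    have "(\<lambda>t. ereal (g t)) \<in> Cs c d \<nu> p w"
      by (rule integrable_truncation_in_Cs[OF assms(1,3) g(1,3,2,4) assms(4) tail[OF g(2)] p])
    moreover have "Ch_norm c d \<nu> p w (\<lambda>x. f x - ereal (g x)) < ennreal \<epsilon>"
      unfolding Ch_norm_def
      using g(5) norm_eq[of "\<lambda>x. LINT t:?S x|lebesgue. real_of_ereal (f t - ereal (g t))"
          "\<lambda>x. prim fr x - prim g x"] prim_difference[OF assms(1,3) f1 g(1,3)]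
      by (intro epowr_inverse_less p \<epsilon>) (simp add: fr_def[abs_def])
    ultimately show ?thesis by (intro bexI[where x = "\<lambda>t. ereal (g t)"])
  qed
  with Cs_subset_Ch[OF assms(1,3) p w_pos] show ?thesis by (simp add: dense_wrt_def)
qed

end
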